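(* Let $p\ge 1$ and $n_1,\dots,n_p\ge 1$ be integers, $n=n_1+\cdots+n_p$, and let $A=(A_{[ab]})_{1\le a,b\le p}$ be an $n\times n$ complex matrix written in block form, with $A_{[ab]}\in M_{n_a,n_b}(\mathbb{C})$. Then $$\det A=\frac{1}{n_1!\cdots n_p!}\sum_{\sigma\in\mathfrak{S}_n}\varepsilon(\sigma)\prod_{(i_1\cdots i_r)\preccurlyeq\sigma}\operatorname{Tr}\left(A_{[\mathsf{b}(i_1)\mathsf{b}(i_2)]}A_{[\mathsf{b}(i_2)\mathsf{b}(i_3)]}\cdots A_{[\mathsf{b}(i_r)\mathsf{b}(i_1)]}\right).$$
   Context: $\mathfrak{S}_n$ is the group of permutations of $\{1,\dots,n\}$ and $\varepsilon(\sigma)$ is the signature of $\sigma$. The notation $c\preccurlyeq\sigma$ means that $c$ is a cycle of $\sigma$; fixed points count as cycles of length $1$, and a cycle $(i_1)$ of length $1$ contributes $\operatorname{Tr}(A_{[\mathsf{b}(i_1)\mathsf{b}(i_1)]})$. The set $\{1,\dots,n\}$ is split into consecutive intervals $I_1=\{1,\dots,n_1\}$, $I_2=\{n_1+1,\dots,n_1+n_2\}$, ..., $I_p=\{n_1+\cdots+n_{p-1}+1,\dots,n\}$ according to the block structure, and $\mathsf{b}(i)\in\{1,\dots,p\}$ is the unique index such that $i\in I_{\mathsf{b}(i)}$. *)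

theory Defs
  imports "Jordan_Normal_Form.Determinant" "HOL-Combinatorics.Cycles"
begin

text \<open>
  All indices start at 0, as in the matrix library: the blocks are numbered
  \<open>0, \<dots>, p - 1\<close>, block \<open>a\<close> has size \<open>ns a\<close>, and permutations act on \<open>{..<n}\<close>.
\<close>

definition block_offset :: "(nat \<Rightarrow> nat) \<Rightarrow> nat \<Rightarrow> nat" where
  "block_offset ns a = (\<Sum>c<a. ns c)"

definition block_interval :: "(nat \<Rightarrow> nat) \<Rightarrow> nat \<Rightarrow> nat set" where
  "block_interval ns a = {block_offset ns a ..< block_offset ns a + ns a}"

definition block_of :: "nat \<Rightarrow> (nat \<Rightarrow> nat) \<Rightarrow> nat \<Rightarrow> nat" where
  "block_of p ns i = (THE a. a < p \<and> i \<in> block_interval ns a)"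

definition block :: "(nat \<Rightarrow> nat) \<Rightarrow> 'a mat \<Rightarrow> nat \<Rightarrow> nat \<Rightarrow> 'a mat" where
  "block ns A a b =
     mat (ns a) (ns b) (\<lambda>(i, j). A $$ (block_offset ns a + i, block_offset ns b + j))"

definition mat_trace :: "'a::comm_monoid_add mat \<Rightarrow> 'a" where
  "mat_trace M = (\<Sum>i<dim_row M. M $$ (i, i))"

text \<open>The product \<open>M\<^sub>1 * \<dots> * M\<^sub>r\<close> of a nonempty list; the sizes of the factors may vary.\<close>

definition mat_list_prod :: "'a::semiring_0 mat list \<Rightarrow> 'a mat" where
  "mat_list_prod Ms = foldl (*) (hd Ms) (tl Ms)"

text \<open>
  The list \<open>[i\<^sub>1, \<dots>, i\<^sub>r]\<close> denotes a cycle of \<open>\<sigma>\<close> if its entries are distinct and \<open>\<sigma>\<close> maps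
  \<open>i\<^sub>1\<close> to \<open>i\<^sub>2\<close>, ..., \<open>i\<^sub>r\<close> to \<open>i\<^sub>1\<close>; a fixed point \<open>i\<close> is denoted by \<open>[i]\<close>.
\<close>

definition is_cycle_of :: "'a list \<Rightarrow> ('a \<Rightarrow> 'a) \<Rightarrow> bool" where
  "is_cycle_of cs \<sigma> \<longleftrightarrow> cs \<noteq> [] \<and> distinct cs \<and> map \<sigma> cs = rotate1 cs"

text \<open>
  Lists that differ by a rotation denote the same cycle. Each cycle of \<open>\<sigma>\<close> on \<open>{..<n}\<close> is
  represented once, by the list starting with its least element
  (\<open>cycles_on_unique\<close>). By \<open>cycle_trace_rotate\<close>
  below this choice does not affect the trace attached to a cycle.
\<close>

definition cycles_on :: "nat \<Rightarrow> (nat \<Rightarrow> nat) \<Rightarrow> nat list set" where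
  "cycles_on n \<sigma> = {cs. is_cycle_of cs \<sigma> \<and> set cs \<subseteq> {..<n} \<and> hd cs = Min (set cs)}"

definition cycle_trace :: "nat \<Rightarrow> (nat \<Rightarrow> nat) \<Rightarrow> 'a::semiring_0 mat \<Rightarrow> nat list \<Rightarrow> 'a" where
  "cycle_trace p ns A cs =
     mat_trace (mat_list_prod
       (map2 (\<lambda>i j. block ns A (block_of p ns i) (block_of p ns j)) cs (rotate1 cs)))"

lemma block_of_unique:
  assumes "i < block_offset ns p"
  shows "\<exists>!a. a < p \<and> i \<in> block_interval ns a"
proof -
  have mono: "block_offset ns a + ns a \<le> block_offset ns b" if "a < b" for a b
    using that
  proof (induction b)
    case (Suc b)
    then show ?case by (cases "a = b") (auto simp: block_offset_def)
  qed simp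
  have "\<exists>a<p. i \<in> block_interval ns a"
    using assms
  proof (induction p)
    case (Suc p)
    then show ?case
      by (cases "i < block_offset ns p")
         (auto simp: block_interval_def block_offset_def less_Suc_eq)
  qed (simp add: block_offset_def)
  moreover have "a = b" if "i \<in> block_interval ns a" "i \<in> block_interval ns b" for a b
    using that mono[of a b] mono[of b a]
    by (cases a b rule: linorder_cases) (auto simp: block_interval_def)
  ultimately show ?thesis by blast
qed

lemma is_cycle_of_rotate: "is_cycle_of (rotate k cs) \<sigma> \<longleftrightarrow> is_cycle_of cs \<sigma>"
proof -
  have "map \<sigma> (rotate k cs) = rotate1 (rotate k cs) \<longleftrightarrow> map \<sigma> cs = rotate1 cs"
  proof -
    have inj: "rotate k xs = rotate k ys \<longleftrightarrow> xs = ys" for xs ys :: "'a list"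
    proof (induction k arbitrary: xs ys)
      case (Suc k)
      have "rotate1 us = rotate1 vs \<longleftrightarrow> us = vs" for us vs :: "'a list"
        by (cases us; cases vs) auto
      then show ?case using Suc by simp
    qed simp
    have "map \<sigma> (rotate k cs) = rotate k (map \<sigma> cs)" by (rule rotate_map [symmetric])
    moreover have "rotate1 (rotate k cs) = rotate k (rotate1 cs)" by (rule rotate1_rotate_swap)
    ultimately show ?thesis by (simp only: inj)
  qed
  then show ?thesis by (simp add: is_cycle_of_def)
qed

lemma cycles_on_unique:
  assumes \<sigma>: "\<sigma> permutes {..<n}" and i: "i < n"
  shows "\<exists>!cs. cs \<in> cycles_on n \<sigma> \<and> i \<in> set cs"
proof -
  have nth_pow: "cs ! k = (\<sigma> ^^ k) (hd cs)" if "is_cycle_of cs \<sigma>" "k < length cs" for cs k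
    using that(2)
  proof (induction k)
    case 0
    then show ?case using that by (simp add: is_cycle_of_def hd_conv_nth)
  next
    case (Suc k)
    have "\<sigma> (cs ! k) = rotate1 cs ! k"
      using that(1) Suc.prems nth_map[of k cs \<sigma>] by (simp add: is_cycle_of_def)
    also have "\<dots> = cs ! Suc k"
      using Suc.prems by (simp add: nth_rotate1)
    finally show ?case using Suc by simp
  qed
  have last: "(\<sigma> ^^ length cs) (hd cs) = hd cs" if "is_cycle_of cs \<sigma>" for cs
  proof -
    have mp: "map \<sigma> cs = rotate1 cs" using that by (simp add: is_cycle_of_def)
    have "0 < length cs" using that by (simp add: is_cycle_of_def)
    then obtain m where m: "length cs = Suc m" by (auto simp: gr0_conv_Suc)
    have "\<sigma> (cs ! m) = rotate1 cs ! m"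
      using m by (simp flip: mp)
    also have "\<dots> = hd cs"
      using m that by (simp add: nth_rotate1 is_cycle_of_def hd_conv_nth)
    finally show ?thesis using nth_pow[OF that, of m] m by simp
  qed
  have eq: "cs = cs'" if c: "is_cycle_of cs \<sigma>" "is_cycle_of cs' \<sigma>" "hd cs = hd cs'" for cs cs'
  proof -
    have *: "length ds \<le> length es"
      if "is_cycle_of ds \<sigma>" "is_cycle_of es \<sigma>" "hd ds = hd es" for ds es
    proof (rule ccontr)
      assume l: "\<not> ?thesis"
      then have "ds ! length es = hd ds"
        using nth_pow[OF that(1)] last[OF that(2)] that(3) by simp
      then have "ds ! length es = ds ! 0"
        using that(1) by (simp add: is_cycle_of_def hd_conv_nth)
      then have "length es = 0"
        using that(1) l by (subst (asm) nth_eq_iff_index_eq) (auto simp: is_cycle_of_def)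
      then show False using that(2) by (simp add: is_cycle_of_def)
    qed
    have "length cs = length cs'" using *[of cs cs'] *[of cs' cs] c by simp
    then show ?thesis by (intro nth_equalityI) (simp_all add: nth_pow c)
  qed
  have set: "set cs = range (\<lambda>k. (\<sigma> ^^ k) j)" if c: "is_cycle_of cs \<sigma>" and j: "j \<in> set cs" for cs j
  proof -
    obtain k where k: "k < length cs" "cs ! k = j" using j by (auto simp: in_set_conv_nth)
    define ds where "ds = rotate k cs"
    have d: "is_cycle_of ds \<sigma>" "set ds = set cs" "hd ds = j"
      using c k hd_rotate_conv_nth[of cs k] length_pos_if_in_set[OF j] by (auto simp: ds_def is_cycle_of_rotate)
    have closed: "\<sigma> x \<in> set ds" if "x \<in> set ds" for x
    proof -
      have "\<sigma> ` set ds = set ds"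
        using d(1) by (metis is_cycle_of_def list.set_map set_rotate1)
      then show ?thesis using that by blast
    qed
    have "(\<sigma> ^^ m) j \<in> set ds" for m
      using d closed by (induction m) (auto simp: is_cycle_of_def)
    moreover have "set ds \<subseteq> range (\<lambda>k. (\<sigma> ^^ k) j)"
      using nth_pow[OF d(1)] d(3) by (auto simp: in_set_conv_nth)
    ultimately show ?thesis using d(2) by auto
  qed
  have "\<exists>cs. cs \<in> cycles_on n \<sigma> \<and> i \<in> set cs"
  proof -
    have perm: "permutation \<sigma>" using \<sigma> by (auto simp: permutation_permutes)
    define ds where "ds = support \<sigma> i"
    have pos: "least_power \<sigma> i > 0" and pw: "(\<sigma> ^^ least_power \<sigma> i) i = i"
      using least_power_of_permutation[OF perm] by auto
    have ds: "is_cycle_of ds \<sigma>"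
      unfolding is_cycle_of_def
    proof (intro conjI nth_equalityI)
      show "ds \<noteq> []" using pos by (simp add: ds_def)
      show "distinct ds" unfolding ds_def by (rule cycle_of_permutation[OF perm])
      fix k assume "k < length (map \<sigma> ds)"
      then have k: "k < least_power \<sigma> i" by (simp add: ds_def)
      have "map \<sigma> ds ! k = (\<sigma> ^^ Suc k) i" using k by (simp add: ds_def)
      moreover have "rotate1 ds ! k = (\<sigma> ^^ (Suc k mod least_power \<sigma> i)) i"
        using k by (simp add: ds_def nth_rotate1)
      moreover have "(\<sigma> ^^ (Suc k mod least_power \<sigma> i)) i = (\<sigma> ^^ Suc k) i"
        using pw by (rule funpow_mod_eq)
      ultimately show "map \<sigma> ds ! k = rotate1 ds ! k" by simp
    qed simp
    have "hd ds = i" using pos by (simp add: ds_def hd_map upt_conv_Cons)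
    then have ids: "i \<in> set ds" using ds by (metis hd_in_set is_cycle_of_def)
    have "(\<sigma> ^^ k) i < n" for k
      using i permutes_in_image[OF \<sigma>] by (induction k) auto
    then have sub: "set ds \<subseteq> {..<n}" using set[OF ds ids] by auto
    have "Min (set ds) \<in> set ds" using ids by (intro Min_in) auto
    then obtain k where k: "k < length ds" "ds ! k = Min (set ds)" by (auto simp: in_set_conv_nth)
    have "rotate k ds \<in> cycles_on n \<sigma>"
      using k ds sub hd_rotate_conv_nth[of ds k] length_pos_if_in_set[OF ids] by (auto simp: cycles_on_def is_cycle_of_rotate)
    then show ?thesis using ids by (metis set_rotate)
  qed
  moreover have "cs = cs'"
    if "cs \<in> cycles_on n \<sigma> \<and> i \<in> set cs" "cs' \<in> cycles_on n \<sigma> \<and> i \<in> set cs'" for cs cs'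
    using that set[of cs i] set[of cs' i] by (intro eq) (auto simp: cycles_on_def)
  ultimately show ?thesis by blast
qed

lemma mat_list_prod_snoc: "Ms \<noteq> [] \<Longrightarrow> mat_list_prod (Ms @ [M]) = mat_list_prod Ms * M"
  by (cases Ms) (simp_all add: mat_list_prod_def)

lemma foldl_mat_chain:
  fixes M :: "'a::semiring_0 mat"
  assumes "M \<in> carrier_mat l (d i)"
    and "\<And>i j. B i j \<in> carrier_mat (d i) (d j)"
  shows "foldl (*) M (map2 B (i # ks) (ks @ [j])) \<in> carrier_mat l (d j) \<and>
     (\<forall>N m. N \<in> carrier_mat m l \<longrightarrow>
       foldl (*) (N * M) (map2 B (i # ks) (ks @ [j])) =
       N * foldl (*) M (map2 B (i # ks) (ks @ [j])))"
  using assms(1)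
proof (induction ks arbitrary: M i)
  case Nil
  have "N * M * B i j = N * (M * B i j)" if "N \<in> carrier_mat m l" for N m
    using that Nil assms(2) by (rule assoc_mult_mat)
  then show ?case using mult_carrier_mat[OF Nil assms(2)] by simp
next
  case (Cons k ks)
  have MB: "M * B i k \<in> carrier_mat l (d k)" using Cons.prems assms(2) by simp
  have as: "N * M * B i k = N * (M * B i k)" if "N \<in> carrier_mat m l" for N m
    using that Cons.prems assms(2) by (rule assoc_mult_mat)
  show ?case
  proof (intro conjI allI impI)
    show "foldl (*) M (map2 B (i # k # ks) ((k # ks) @ [j])) \<in> carrier_mat l (d j)"
      using Cons.IH[OF MB, THEN conjunct1] by simp
    fix N :: "'a mat" and m
    assume N: "N \<in> carrier_mat m l"
    show "foldl (*) (N * M) (map2 B (i # k # ks) ((k # ks) @ [j])) =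
        N * foldl (*) M (map2 B (i # k # ks) ((k # ks) @ [j]))"
      using Cons.IH[OF MB, THEN conjunct2, rule_format, OF N] by (simp add: as[OF N])
  qed
qed

lemma mat_trace_comm:
  fixes M N :: "'a::comm_semiring_0 mat"
  assumes "M \<in> carrier_mat r s" "N \<in> carrier_mat s r"
  shows "mat_trace (M * N) = mat_trace (N * M)"
proof -
  have "mat_trace (M * N) = (\<Sum>i<r. \<Sum>j<s. M $$ (i, j) * N $$ (j, i))"
    using assms by (simp add: mat_trace_def scalar_prod_def atLeast0LessThan)
  also have "\<dots> = (\<Sum>j<s. \<Sum>i<r. N $$ (j, i) * M $$ (i, j))"
    by (subst sum.swap) (simp add: mult.commute)
  also have "\<dots> = mat_trace (N * M)"
    using assms by (simp add: mat_trace_def scalar_prod_def atLeast0LessThan)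
  finally show ?thesis .
qed

lemma cycle_trace_rotate1:
  fixes A :: "'a::comm_semiring_1 mat"
  shows "cycle_trace p ns A (rotate1 cs) = cycle_trace p ns A cs"
proof (cases cs)
  case (Cons x xs)
  define B where "B = (\<lambda>i j. block ns A (block_of p ns i) (block_of p ns j))"
  define d where "d = (\<lambda>i. ns (block_of p ns i))"
  have B: "B i j \<in> carrier_mat (d i) (d j)" for i j
    by (simp add: B_def d_def block_def)
  show ?thesis
  proof (cases xs)
    case (Cons y ys)
    let ?P = "foldl (*) (1\<^sub>m (d y)) (map2 B (y # ys) (ys @ [x]))"
    have one: "1\<^sub>m (d y) \<in> carrier_mat (d y) (d y)" by simp
    note chain = foldl_mat_chain[where d = d and B = B and i = y and j = x and ks = ys, OF one B]
    have P: "?P \<in> carrier_mat (d y) (d x)"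
      using chain by (rule conjunct1)
    have PB: "foldl (*) (B x y * 1\<^sub>m (d y)) (map2 B (y # ys) (ys @ [x])) = B x y * ?P"
      by (rule chain[THEN conjunct2, rule_format]) (rule B)
    have 1: "mat_list_prod (map2 B cs (rotate1 cs)) = B x y * ?P"
      using PB right_mult_one_mat[OF B] \<open>cs = x # xs\<close> Cons
      by (simp add: mat_list_prod_def)
    have hd: "?P = mat_list_prod (map2 B (y # ys) (ys @ [x]))"
    proof -
      obtain z zs where "ys @ [x] = z # zs" by (cases "ys @ [x]") auto
      then show ?thesis using left_mult_one_mat[OF B] by (simp add: mat_list_prod_def)
    qed
    have "map2 B (y # ys @ [x]) ((ys @ [x]) @ [y]) = map2 B (y # ys) (ys @ [x]) @ [B x y]"
      using zip_append[of "y # ys" "ys @ [x]" "[x]" "[y]"] by simp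
    moreover have "map2 B (y # ys) (ys @ [x]) \<noteq> []" by (cases ys) auto
    ultimately have "mat_list_prod (map2 B (rotate1 cs) (rotate1 (rotate1 cs))) = ?P * B x y"
      unfolding hd by (simp add: \<open>cs = x # xs\<close> Cons mat_list_prod_snoc del: zip_append)
    with 1 show ?thesis
      using mat_trace_comm[OF P B] by (simp add: cycle_trace_def flip: B_def)
  qed (simp add: Cons)
qed simp

lemma cycle_trace_rotate:
  fixes A :: "'a::comm_semiring_1 mat"
  shows "cycle_trace p ns A (rotate k cs) = cycle_trace p ns A cs"
  by (induction k) (simp_all add: cycle_trace_rotate1)

end

theory Submission
  imports Defs
begin

text \<open>
  Expanding a trace of a product of blocks along a cycle \<open>(i\<^sub>1 \<dots> i\<^sub>r)\<close> of \<open>\<sigma>\<close> introduces one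
  summation index for each element of the cycle, and the index \<open>f i\<close> attached to \<open>i\<close> runs over the
  block interval that contains \<open>i\<close>; the summand is the product of the entries
  \<open>A (f i, f (\<sigma> i))\<close> (\<open>cycle_trace_expand\<close>). Since the cycles of \<open>\<sigma>\<close> partition \<open>{..<n}\<close>, multiplying
  out over all cycles gives one sum over all \<open>f\<close> on \<open>{..<n}\<close> that map every \<open>i\<close> into its own block
  (\<open>prod_cycle_traces\<close>). The range of this sum does not depend on \<open>\<sigma>\<close>.

  The two sums can therefore be exchanged. For a fixed \<open>f\<close>, the signed sum over \<open>\<sigma>\<close> is the Leibniz
  expansion of the determinant of the matrix with entries \<open>A (f i, f j)\<close>. If \<open>f\<close> is not injective,
  this matrix has two equal rows and the determinant vanishes; if \<open>f\<close> is injective, it permutes the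
  rows and the columns of \<open>A\<close> in the same way, so the two signs cancel and the determinant is
  \<open>det A\<close> (\<open>det_reindex\<close>). It remains to count the injective \<open>f\<close>: they consist of an independent
  permutation of each block, so there are \<open>n\<^sub>1! \<cdots> n\<^sub>p!\<close> of them (\<open>sum_of_bool_inj_blocks\<close>).
\<close>

section \<open>Sums over families of choices\<close>

lemma sum_PiE_insert:
  assumes "x \<notin> S"
  shows "(\<Sum>g\<in>PiE (insert x S) T. F g) = (\<Sum>y\<in>T x. \<Sum>g\<in>PiE S T. F (g(x := y)))"
proof -
  have "(\<Sum>g\<in>PiE (insert x S) T. F g) = (\<Sum>(y, g)\<in>T x \<times> PiE S T. F (g(x := y)))"
    unfolding PiE_insert_eq using inj_combinator[OF assms, of T]
    by (subst sum.reindex) (auto simp: case_prod_unfold o_def)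
  then show ?thesis by (simp add: sum.cartesian_product)
qed

text \<open>
  A function on a disjoint union is the same as a family of functions on the parts, so this is the
  distributive law for a product of sums of which each runs over functions on one part. It serves
  twice: for the partition of \<open>{..<n}\<close> into the cycles of a permutation, and for its partition into
  blocks.
\<close>

lemma prod_sum_PiE_UN:
  fixes F :: "'c \<Rightarrow> ('a \<Rightarrow> 'b) \<Rightarrow> 'r::comm_semiring_1"
  assumes "finite C" and "\<And>c. c \<in> C \<Longrightarrow> finite (S c)"
    and "\<And>c x. c \<in> C \<Longrightarrow> x \<in> S c \<Longrightarrow> finite (T x)"
    and disj: "disjoint_family_on S C"
  shows "(\<Prod>c\<in>C. \<Sum>g\<in>PiE (S c) T. F c g) =
    (\<Sum>f\<in>PiE (\<Union>c\<in>C. S c) T. \<Prod>c\<in>C. F c (restrict f (S c)))"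
proof -
  define idx where "idx = (\<lambda>x. THE c. c \<in> C \<and> x \<in> S c)"
  have idx: "idx x = c" if "c \<in> C" "x \<in> S c" for x c
    unfolding idx_def using that disj by (intro the_equality) (auto simp: disjoint_family_on_def)
  have "(\<Prod>c\<in>C. \<Sum>g\<in>PiE (S c) T. F c g) =
    (\<Sum>G\<in>(\<Pi>\<^sub>E c\<in>C. PiE (S c) T). \<Prod>c\<in>C. F c (G c))"
    using assms by (intro prod_sum_PiE finite_PiE) auto
  also have "\<dots> = (\<Sum>f\<in>PiE (\<Union>c\<in>C. S c) T. \<Prod>c\<in>C. F c (restrict f (S c)))"
  proof (rule sum.reindex_bij_witness[where
        i = "\<lambda>f. \<lambda>c\<in>C. restrict f (S c)" and j = "\<lambda>G. \<lambda>x\<in>(\<Union>c\<in>C. S c). G (idx x) x"])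
    fix G assume G: "G \<in> (\<Pi>\<^sub>E c\<in>C. PiE (S c) T)"
    have restr: "restrict (\<lambda>x\<in>(\<Union>c\<in>C. S c). G (idx x) x) (S c) = G c" if "c \<in> C" for c
    proof
      fix x
      have "G c \<in> PiE (S c) T" using G that by auto
      then show "restrict (\<lambda>x\<in>(\<Union>c\<in>C. S c). G (idx x) x) (S c) x = G c x"
        using that by (auto simp: idx PiE_def extensional_def)
    qed
    then show "(\<lambda>c\<in>C. restrict (\<lambda>x\<in>(\<Union>c\<in>C. S c). G (idx x) x) (S c)) = G"
      using G by (intro ext) (auto simp: PiE_def extensional_def)
    show "(\<lambda>x\<in>(\<Union>c\<in>C. S c). G (idx x) x) \<in> PiE (\<Union>c\<in>C. S c) T"
      using G by (auto simp: idx PiE_iff)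
    show "(\<Prod>c\<in>C. F c (restrict (\<lambda>x\<in>(\<Union>c\<in>C. S c). G (idx x) x) (S c))) = (\<Prod>c\<in>C. F c (G c))"
      using restr by (intro prod.cong) auto
  next
    fix f assume f: "f \<in> PiE (\<Union>c\<in>C. S c) T"
    show "(\<lambda>x\<in>(\<Union>c\<in>C. S c). (\<lambda>c\<in>C. restrict f (S c)) (idx x) x) = f"
    proof
      fix x
      show "(\<lambda>x\<in>(\<Union>c\<in>C. S c). (\<lambda>c\<in>C. restrict f (S c)) (idx x) x) x = f x"
      proof (cases "x \<in> (\<Union>c\<in>C. S c)")
        case True
        then show ?thesis using idx by auto
      next
        case False
        then show ?thesis using PiE_arb[OF f] by simp
      qed
    qed
    show "(\<lambda>c\<in>C. restrict f (S c)) \<in> (\<Pi>\<^sub>E c\<in>C. PiE (S c) T)"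
      using f by (auto simp: PiE_iff)
  qed
  finally show ?thesis .
qed

section \<open>Traces of cyclic products\<close>

text \<open>
  The entries of a matrix product as sums over index paths, where the path is a function on the
  labels of the factors. Distinct labels make such functions the same as free choices of one index
  per label. An arbitrary first factor \<open>M\<close> lets the induction absorb the factors one by one.
\<close>

lemma foldl_mat_entry:
  fixes M :: "'a::comm_semiring_1 mat"
  assumes "M \<in> carrier_mat l (d i)" and B: "\<And>i j. B i j \<in> carrier_mat (d i) (d j)"
    and "distinct (i # ks)" and u: "u < l" and v: "v < d j"
  shows "foldl (*) M (map2 B (i # ks) (ks @ [j])) $$ (u, v) =
    (\<Sum>g\<in>PiE (set (i # ks)) (\<lambda>k. {..<d k}).
      M $$ (u, g i) * (\<Prod>(k, k')\<leftarrow>zip (i # ks) ks. B k k' $$ (g k, g k')) *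
      B (last (i # ks)) j $$ (g (last (i # ks)), v))"
  using assms(1,3)
proof (induction ks arbitrary: M i)
  case Nil
  have "(M * B i j) $$ (u, v) = (\<Sum>s<d i. M $$ (u, s) * B i j $$ (s, v))"
    using Nil(1) B[of i j] u v by (simp add: scalar_prod_def atLeast0LessThan)
  then show ?case by (simp add: sum_PiE_insert)
next
  case (Cons k ks)
  define R where "R g = (\<Prod>(k, k')\<leftarrow>zip (k # ks) ks. B k k' $$ (g k, g k')) *
      B (last (k # ks)) j $$ (g (last (k # ks)), v)" for g
  \<comment> \<open>By distinctness the remaining path avoids \<open>i\<close>, so the index chosen at \<open>i\<close> can be summed first.\<close>
  have R: "R (g(i := s)) = R g" for g s
  proof -
    have "last (k # ks) \<noteq> i"
      using Cons.prems(2) last_in_set[of "k # ks"] by (metis distinct.simps(2) list.distinct(1))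
    moreover have "(\<Prod>(k, k')\<leftarrow>zip (k # ks) ks. B k k' $$ ((g(i := s)) k, (g(i := s)) k'))
      = (\<Prod>(k, k')\<leftarrow>zip (k # ks) ks. B k k' $$ (g k, g k'))"
    proof -
      have "a \<noteq> i \<and> b \<noteq> i" if "(a, b) \<in> set (zip (k # ks) ks)" for a b
        using set_zip_leftD[OF that] set_zip_rightD[OF that] Cons.prems(2)
        by (metis distinct.simps(2) list.set_intros(2))
      then show ?thesis by (intro arg_cong[of _ _ prod_list] map_cong refl) auto
    qed
    ultimately show ?thesis unfolding R_def by simp
  qed
  have MB: "M * B i k \<in> carrier_mat l (d k)" using Cons.prems(1) B by simp
  have entry: "(M * B i k) $$ (u, t) = (\<Sum>s<d i. M $$ (u, s) * B i k $$ (s, t))" if "t < d k" for t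
    using Cons.prems(1) B[of i k] u that by (simp add: scalar_prod_def atLeast0LessThan)
  let ?P = "PiE (set (k # ks)) (\<lambda>k. {..<d k})"
  have "foldl (*) M (map2 B (i # k # ks) ((k # ks) @ [j])) $$ (u, v) =
      (\<Sum>g\<in>?P. (M * B i k) $$ (u, g k) * R g)"
    using Cons.IH[OF MB] Cons.prems(2) by (simp add: R_def mult.assoc)
  also have "\<dots> = (\<Sum>g\<in>?P. \<Sum>s<d i. M $$ (u, s) * B i k $$ (s, g k) * R g)"
    by (intro sum.cong refl, subst entry) (auto simp: sum_distrib_right PiE_iff)
  also have "\<dots> = (\<Sum>s<d i. \<Sum>g\<in>?P. M $$ (u, s) * B i k $$ (s, g k) * R g)"
    by (rule sum.swap)
  also have "\<dots> = (\<Sum>g\<in>PiE (insert i (set (k # ks))) (\<lambda>k. {..<d k}).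
      M $$ (u, g i) * B i k $$ (g i, g k) * R g)"
    using Cons.prems(2) by (subst sum_PiE_insert) (auto simp: R)
  finally show ?case by (simp add: R_def mult.assoc)
qed

lemma zip_Cons_snoc_last: "zip (i # ks) (ks @ [j]) = zip (i # ks) ks @ [(last (i # ks), j)]"
  by (induction ks arbitrary: i) auto

text \<open>
  The trace identifies the two end indices of the path, which closes it to a cycle: the successor
  of every label is then its image under \<open>\<sigma>\<close>, so the product over consecutive labels becomes one over the set of
  labels.
\<close>

lemma trace_cyclic_product:
  fixes B :: "nat \<Rightarrow> nat \<Rightarrow> 'a::comm_semiring_1 mat"
  assumes c: "is_cycle_of cs \<sigma>" and B: "\<And>i j. B i j \<in> carrier_mat (d i) (d j)"
  shows "mat_trace (mat_list_prod (map2 B cs (rotate1 cs))) =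
    (\<Sum>g\<in>PiE (set cs) (\<lambda>i. {..<d i}). \<Prod>i\<in>set cs. B i (\<sigma> i) $$ (g i, g (\<sigma> i)))"
proof -
  obtain i ks where cs: "cs = i # ks" using c by (cases cs) (auto simp: is_cycle_of_def)
  have dist: "distinct cs" and rot: "rotate1 cs = map \<sigma> cs" using c by (auto simp: is_cycle_of_def)
  let ?I = "1\<^sub>m (d i) :: 'a mat" and ?P = "PiE (set cs) (\<lambda>i. {..<d i})"
  define W where "W g = (\<Prod>(k, k')\<leftarrow>zip (i # ks) ks. B k k' $$ (g k, g k'))" for g
  \<comment> \<open>With the identity as first factor, the entry \<open>(v, g i)\<close> of \<open>?I\<close> forces \<open>v = g i\<close>.\<close>
  let ?m = "foldl (*) ?I (map2 B (i # ks) (ks @ [i]))"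
  have m: "mat_list_prod (map2 B cs (rotate1 cs)) = ?m"
  proof -
    obtain z zs where "ks @ [i] = z # zs" by (cases "ks @ [i]") auto
    then show ?thesis using left_mult_one_mat[OF B] by (simp add: cs mat_list_prod_def)
  qed
  have I: "?I \<in> carrier_mat (d i) (d i)" by simp
  have dim: "dim_row ?m = d i"
    using foldl_mat_chain[where d = d and B = B and i = i and j = i and ks = ks, OF I B] by blast
  have W: "W g * B (last (i # ks)) i $$ (g (last (i # ks)), g i)
      = (\<Prod>i\<in>set cs. B i (\<sigma> i) $$ (g i, g (\<sigma> i)))" for g
  proof -
    have "W g * B (last (i # ks)) i $$ (g (last (i # ks)), g i)
        = (\<Prod>(k, k')\<leftarrow>zip cs (rotate1 cs). B k k' $$ (g k, g k'))"
      using zip_Cons_snoc_last[of i ks i] by (simp add: W_def cs del: zip_append)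
    also have "\<dots> = (\<Prod>k\<leftarrow>cs. B k (\<sigma> k) $$ (g k, g (\<sigma> k)))"
      unfolding rot by (simp add: zip_map2 zip_same_conv_map o_def)
    finally show ?thesis using dist by (simp add: prod.distinct_set_conv_list)
  qed
  have "mat_trace ?m = (\<Sum>v<d i. \<Sum>g\<in>?P. ?I $$ (v, g i) * W g *
      B (last (i # ks)) i $$ (g (last (i # ks)), v))"
    unfolding mat_trace_def dim
  proof (rule sum.cong[OF refl])
    fix v assume "v \<in> {..<d i}"
    then have "v < d i" by simp
    from foldl_mat_entry[where B = B and d = d, OF I B _ this this, of ks]
    show "?m $$ (v, v) = (\<Sum>g\<in>?P. ?I $$ (v, g i) * W g *
      B (last (i # ks)) i $$ (g (last (i # ks)), v))"
      using dist unfolding cs W_def by blast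
  qed
  also have "\<dots> = (\<Sum>g\<in>?P. \<Sum>v<d i. ?I $$ (v, g i) * W g *
      B (last (i # ks)) i $$ (g (last (i # ks)), v))"
    by (rule sum.swap)
  also have "\<dots> = (\<Sum>g\<in>?P. W g * B (last (i # ks)) i $$ (g (last (i # ks)), g i))"
  proof (rule sum.cong[OF refl])
    fix g assume "g \<in> ?P"
    then have gi: "g i < d i" by (auto simp: cs)
    have "(\<Sum>v<d i. ?I $$ (v, g i) * W g * B (last (i # ks)) i $$ (g (last (i # ks)), v))
        = (\<Sum>v<d i. if v = g i then W g * B (last (i # ks)) i $$ (g (last (i # ks)), v) else 0)"
      using gi by (intro sum.cong) auto
    then show "(\<Sum>v<d i. ?I $$ (v, g i) * W g * B (last (i # ks)) i $$ (g (last (i # ks)), v))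
        = W g * B (last (i # ks)) i $$ (g (last (i # ks)), g i)"
      using gi by simp
  qed
  finally show ?thesis unfolding m W .
qed

text \<open>
  The index inside a block, which starts at 0, is shifted by the offset of the block, so that the
  summand refers to entries of \<open>A\<close> itself and the choice at \<open>i\<close> ranges over the interval of its block.
\<close>

lemma cycle_trace_expand:
  fixes A :: "'a::comm_semiring_1 mat"
  assumes c: "is_cycle_of cs \<sigma>"
  shows "cycle_trace p ns A cs =
    (\<Sum>f\<in>(\<Pi>\<^sub>E i\<in>set cs. block_interval ns (block_of p ns i)). \<Prod>i\<in>set cs. A $$ (f i, f (\<sigma> i)))"
proof -
  define b where "b = block_of p ns"
  define off where "off = (\<lambda>i. block_offset ns (b i))"
  have \<sigma>: "\<sigma> i \<in> set cs" if "i \<in> set cs" for i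
    using c that by (metis image_eqI is_cycle_of_def list.set_map set_rotate1)
  have "cycle_trace p ns A cs = (\<Sum>g\<in>PiE (set cs) (\<lambda>i. {..<ns (b i)}).
      \<Prod>i\<in>set cs. block ns A (b i) (b (\<sigma> i)) $$ (g i, g (\<sigma> i)))"
    unfolding cycle_trace_def b_def
    using trace_cyclic_product[OF c, of "\<lambda>i j. block ns A (block_of p ns i) (block_of p ns j)"
      "\<lambda>i. ns (block_of p ns i)"]
    by (simp add: block_def)
  also have "\<dots> = (\<Sum>g\<in>PiE (set cs) (\<lambda>i. {..<ns (b i)}).
      \<Prod>i\<in>set cs. A $$ (off i + g i, off (\<sigma> i) + g (\<sigma> i)))"
    by (intro sum.cong prod.cong refl) (auto simp: block_def off_def \<sigma> PiE_iff)
  also have "\<dots> = (\<Sum>f\<in>(\<Pi>\<^sub>E i\<in>set cs. block_interval ns (b i)).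
      \<Prod>i\<in>set cs. A $$ (f i, f (\<sigma> i)))"
  proof (rule sum.reindex_bij_witness[where
        i = "\<lambda>f. \<lambda>i\<in>set cs. f i - off i" and j = "\<lambda>g. \<lambda>i\<in>set cs. off i + g i"])
    fix f assume f: "f \<in> (\<Pi>\<^sub>E i\<in>set cs. block_interval ns (b i))"
    show "(\<lambda>i\<in>set cs. off i + (\<lambda>i\<in>set cs. f i - off i) i) = f"
    proof
      fix x show "(\<lambda>i\<in>set cs. off i + (\<lambda>i\<in>set cs. f i - off i) i) x = f x"
        using f by (cases "x \<in> set cs") (force simp: PiE_iff block_interval_def off_def extensional_def)+
    qed
    show "(\<lambda>i\<in>set cs. f i - off i) \<in> PiE (set cs) (\<lambda>i. {..<ns (b i)})"
      using f by (fastforce simp: PiE_iff block_interval_def off_def)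
  next
    fix g assume g: "g \<in> PiE (set cs) (\<lambda>i. {..<ns (b i)})"
    show "(\<lambda>i\<in>set cs. (\<lambda>i\<in>set cs. off i + g i) i - off i) = g"
      using g by (intro ext) (auto simp: PiE_iff extensional_def)
    show "(\<lambda>i\<in>set cs. off i + g i) \<in> (\<Pi>\<^sub>E i\<in>set cs. block_interval ns (b i))"
      using g by (auto simp: PiE_iff block_interval_def off_def)
  qed (auto simp: \<sigma> intro!: prod.cong)
  finally show ?thesis by (simp add: b_def)
qed

lemma prod_cycle_traces:
  fixes A :: "'a::comm_semiring_1 mat"
  assumes \<sigma>: "\<sigma> permutes {..<n}"
  shows "(\<Prod>cs\<in>cycles_on n \<sigma>. cycle_trace p ns A cs) =
    (\<Sum>f\<in>(\<Pi>\<^sub>E i\<in>{..<n}. block_interval ns (block_of p ns i)). \<Prod>i<n. A $$ (f i, f (\<sigma> i)))"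
proof -
  let ?C = "cycles_on n \<sigma>" and ?T = "\<lambda>i. block_interval ns (block_of p ns i)"
  have C: "is_cycle_of cs \<sigma>" "set cs \<subseteq> {..<n}" if "cs \<in> ?C" for cs
    using that by (auto simp: cycles_on_def)
  have un: "(\<Union>cs\<in>?C. set cs) = {..<n}"
    using C(2) cycles_on_unique[OF \<sigma>] by fastforce
  have disj: "disjoint_family_on set ?C"
    unfolding disjoint_family_on_def using C(2) cycles_on_unique[OF \<sigma>] by blast
  have fin: "finite ?C"
    by (rule finite_subset[OF _ finite_subset_distinct[of "{..<n}"]])
      (auto simp: cycles_on_def is_cycle_of_def)
  have maps: "\<sigma> i \<in> set cs" if "cs \<in> ?C" "i \<in> set cs" for cs i
    using C(1)[OF that(1)] that(2) by (metis image_eqI is_cycle_of_def list.set_map set_rotate1)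
  have "(\<Prod>cs\<in>?C. cycle_trace p ns A cs) =
      (\<Prod>cs\<in>?C. \<Sum>f\<in>PiE (set cs) ?T. \<Prod>i\<in>set cs. A $$ (f i, f (\<sigma> i)))"
    by (intro prod.cong refl cycle_trace_expand C(1))
  also have "\<dots> = (\<Sum>f\<in>PiE (\<Union>cs\<in>?C. set cs) ?T.
      \<Prod>cs\<in>?C. \<Prod>i\<in>set cs. A $$ (restrict f (set cs) i, restrict f (set cs) (\<sigma> i)))"
    by (rule prod_sum_PiE_UN) (auto simp: fin disj block_interval_def)
  also have "\<dots> = (\<Sum>f\<in>PiE {..<n} ?T. \<Prod>cs\<in>?C. \<Prod>i\<in>set cs. A $$ (f i, f (\<sigma> i)))"
    unfolding un by (intro sum.cong prod.cong refl) (simp add: maps)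
  also have "\<dots> = (\<Sum>f\<in>PiE {..<n} ?T. \<Prod>i<n. A $$ (f i, f (\<sigma> i)))"
    using disj fin
    by (simp flip: un add: prod.UNION_disjoint disjoint_family_on_def)
  finally show ?thesis .
qed

section \<open>The partition into blocks\<close>

lemma block_of_in_interval:
  assumes "i < block_offset ns p"
  shows "block_of p ns i < p" and "i \<in> block_interval ns (block_of p ns i)"
  unfolding block_of_def using theI'[OF block_of_unique[OF assms]] by simp_all

lemma block_interval_subset:
  assumes "a < p"
  shows "block_interval ns a \<subseteq> {..<block_offset ns p}"
proof -
  have "block_offset ns a + ns a = (\<Sum>c<Suc a. ns c)" by (simp add: block_offset_def)
  also have "\<dots> \<le> block_offset ns p"
    unfolding block_offset_def using assms by (intro sum_mono2) auto
  finally show ?thesis by (auto simp: block_interval_def)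
qed

lemma block_of_eqI:
  assumes "a < p" "i \<in> block_interval ns a"
  shows "block_of p ns i = a"
proof -
  have "i < block_offset ns p" using block_interval_subset[OF assms(1)] assms(2) by blast
  then show ?thesis using assms block_of_unique block_of_in_interval by blast
qed

section \<open>Reindexing a determinant\<close>

lemma det_reindex:
  fixes A :: "'a::comm_ring_1 mat"
  assumes A: "A \<in> carrier_mat n n" and f: "f ` {..<n} \<subseteq> {..<n}"
  shows "det (mat n n (\<lambda>(i, j). A $$ (f i, f j))) = of_bool (inj_on f {..<n}) * det A"
proof (cases "inj_on f {..<n}")
  case True
  \<comment> \<open>The values of \<open>f\<close> outside \<open>{..<n}\<close> are unknown, whereas a permutation has to fix these points.\<close>
  define \<pi> where "\<pi> i = (if i < n then f i else i)" for i
  have "f ` {..<n} = {..<n}" using True f by (intro endo_inj_surj) auto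
  then have "bij_betw \<pi> {..<n} {..<n}"
    using True by (auto simp: bij_betw_def \<pi>_def inj_on_def image_def)
  then have \<pi>: "\<pi> permutes {0..<n}"
    by (intro bij_imp_permutes) (auto simp: \<pi>_def atLeast0LessThan)
  let ?R = "mat n n (\<lambda>(i, j). A $$ (\<pi> i, j))"
  have \<pi>_less: "\<pi> i < n" if "i < n" for i
    using permutes_in_image[OF \<pi>, of i] that by simp
  \<comment> \<open>The column permutation is a row permutation of the transpose.\<close>
  have "mat n n (\<lambda>(i, j). A $$ (f i, f j)) =
      transpose_mat (mat n n (\<lambda>(i, j). transpose_mat ?R $$ (\<pi> i, j)))"
    using \<pi>_less by (intro eq_matI) (auto simp: \<pi>_def)
  then have "det (mat n n (\<lambda>(i, j). A $$ (f i, f j))) =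
      det (mat n n (\<lambda>(i, j). transpose_mat ?R $$ (\<pi> i, j)))"
    by (simp add: det_transpose[of _ n])
  also have "\<dots> = of_int (sign \<pi>) * det (transpose_mat ?R)"
    by (rule det_permute_rows[OF _ \<pi>]) simp
  also have "det (transpose_mat ?R) = of_int (sign \<pi>) * det A"
    using det_permute_rows[OF A \<pi>] by (simp add: det_transpose[of _ n])
  finally show ?thesis
    using True by (simp add: sign_def)
next
  case False
  then obtain i j where ij: "i < n" "j < n" "i \<noteq> j" "f i = f j"
    by (auto simp: inj_on_def)
  have "det (mat n n (\<lambda>(i, j). A $$ (f i, f j))) = 0"
    using ij by (intro det_identical_rows[of _ n i j] eq_vecI) auto
  with False show ?thesis by simp
qed

section \<open>Counting the block-preserving permutations\<close>

lemma card_inj_funcset_self: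
  assumes "finite S"
  shows "card {g \<in> S \<rightarrow>\<^sub>E S. inj_on g S} = fact (card S)"
  using card_inj_on_subset_funcset[OF assms assms subset_refl]
  by (simp add: fact_prod_rev)

text \<open>
  A function that maps each block into itself is injective if and only if it is injective on every
  block, because the blocks are disjoint. The number of such functions therefore factors over the
  blocks, by the same distributive law as the product of the traces, and each factor counts the
  injections of a block into itself.
\<close>

lemma sum_of_bool_inj_blocks:
  assumes n: "n = (\<Sum>a<p. ns a)"
  shows "(\<Sum>f\<in>(\<Pi>\<^sub>E i\<in>{..<n}. block_interval ns (block_of p ns i)).
      of_bool (inj_on f {..<n})) = ((\<Prod>a<p. fact (ns a)) :: 'a::{comm_semiring_1, semiring_char_0})"
proof -
  let ?I = "block_interval ns" and ?b = "block_of p ns"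
  have n': "n = block_offset ns p" by (simp add: n block_offset_def)
  have b: "?b i < p \<and> i \<in> ?I (?b i)" if "i < n" for i
    using block_of_in_interval[of i ns p] that n' by simp
  have sub: "?I a \<subseteq> {..<n}" if "a < p" for a
    using block_interval_subset[OF that] n' by simp
  note b_eq = block_of_eqI[where p = p and ns = ns]
  have un: "(\<Union>a<p. ?I a) = {..<n}" using sub b by blast
  have disj: "disjoint_family_on ?I {..<p}"
    unfolding disjoint_family_on_def using b_eq by (metis disjoint_iff lessThan_iff)
  have fact_I: "(\<Sum>g\<in>PiE (?I a) (\<lambda>i. ?I (?b i)). of_bool (inj_on g (?I a))) = (fact (ns a) :: 'a)"
    if "a < p" for a
  proof -
    have "PiE (?I a) (\<lambda>i. ?I (?b i)) = (?I a \<rightarrow>\<^sub>E ?I a)"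
      using b_eq[OF that] by (intro PiE_cong) simp
    then have "(\<Sum>g\<in>PiE (?I a) (\<lambda>i. ?I (?b i)). of_bool (inj_on g (?I a))) =
        (of_nat (card {g \<in> ?I a \<rightarrow>\<^sub>E ?I a. inj_on g (?I a)}) :: 'a)"
      by (simp add: sum_of_bool_eq finite_PiE block_interval_def Int_def)
    then show ?thesis
      by (subst (asm) card_inj_funcset_self) (simp_all add: block_interval_def)
  qed
  have inj: "inj_on f {..<n} \<longleftrightarrow> (\<forall>a<p. inj_on f (?I a))"
    if f: "f \<in> PiE {..<n} (\<lambda>i. ?I (?b i))" for f
  proof
    assume R: "\<forall>a<p. inj_on f (?I a)"
    show "inj_on f {..<n}"
    proof (rule inj_onI)
      fix i j assume ij: "i \<in> {..<n}" "j \<in> {..<n}" "f i = f j"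
      have "?b (f k) = ?b k" if "k < n" for k
        using b_eq[of "?b k" "f k"] b[OF that] PiE_mem[OF f, of k] that by simp
      from this[of i] this[of j] have "?b (f i) = ?b i" "?b (f j) = ?b j" using ij by auto
      then have "?b i = ?b j" using ij by simp
      then show "i = j" using R b[of i] b[of j] ij by (auto dest: inj_onD)
    qed
  qed (use sub in \<open>blast intro: inj_on_subset\<close>)
  have "(\<Prod>a<p. fact (ns a)) =
      (\<Prod>a<p. \<Sum>g\<in>PiE (?I a) (\<lambda>i. ?I (?b i)). of_bool (inj_on g (?I a)) :: 'a)"
    by (intro prod.cong refl) (simp add: fact_I)
  also have "\<dots> = (\<Sum>f\<in>PiE (\<Union>a<p. ?I a) (\<lambda>i. ?I (?b i)).
      \<Prod>a<p. of_bool (inj_on (restrict f (?I a)) (?I a)))"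
    by (rule prod_sum_PiE_UN) (auto simp: disj, auto simp: block_interval_def)
  also have "\<dots> = (\<Sum>f\<in>PiE {..<n} (\<lambda>i. ?I (?b i)). of_bool (inj_on f {..<n}))"
    unfolding un
  proof (intro sum.cong refl)
    fix f assume f: "f \<in> PiE {..<n} (\<lambda>i. ?I (?b i))"
    show "(\<Prod>a<p. of_bool (inj_on (restrict f (?I a)) (?I a))) = (of_bool (inj_on f {..<n}) :: 'a)"
      unfolding inj[OF f] inj_on_restrict_eq by (induction p) (auto simp: less_Suc_eq)
  qed
  finally show ?thesis ..
qed

section \<open>The determinant formula\<close>

theorem proposition1p1:
  fixes p n :: nat and ns :: "nat \<Rightarrow> nat" and A :: "complex mat"
  assumes "p \<ge> 1"
    and "\<And>a. a < p \<Longrightarrow> ns a \<ge> 1"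
    and "n = (\<Sum>a<p. ns a)"
    and "A \<in> carrier_mat n n"
  shows "det A =
    1 / (\<Prod>a<p. fact (ns a)) *
    (\<Sum>\<sigma> | \<sigma> permutes {..<n}.
       of_int (sign \<sigma>) * (\<Prod>cs\<in>cycles_on n \<sigma>. cycle_trace p ns A cs))"
proof -
  let ?F = "\<Pi>\<^sub>E i\<in>{..<n}. block_interval ns (block_of p ns i)"
  have "(\<Sum>\<sigma> | \<sigma> permutes {..<n}.
        of_int (sign \<sigma>) * (\<Prod>cs\<in>cycles_on n \<sigma>. cycle_trace p ns A cs)) =
      (\<Sum>\<sigma> | \<sigma> permutes {..<n}. \<Sum>f\<in>?F. of_int (sign \<sigma>) * (\<Prod>i<n. A $$ (f i, f (\<sigma> i))))"
    by (intro sum.cong refl) (simp add: prod_cycle_traces sum_distrib_left)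
  also have "\<dots> = (\<Sum>f\<in>?F. \<Sum>\<sigma> | \<sigma> permutes {..<n}.
      of_int (sign \<sigma>) * (\<Prod>i<n. A $$ (f i, f (\<sigma> i))))"
    by (rule sum.swap)
  also have "\<dots> = (\<Sum>f\<in>?F. det (mat n n (\<lambda>(i, j). A $$ (f i, f j))))"
  proof (intro sum.cong refl)
    fix f
    have "det (mat n n (\<lambda>(i, j). A $$ (f i, f j))) = (\<Sum>\<sigma> | \<sigma> permutes {..<n}.
        of_int (sign \<sigma>) * (\<Prod>i<n. mat n n (\<lambda>(i, j). A $$ (f i, f j)) $$ (i, \<sigma> i)))"
      by (subst det_def'[of _ n]) (simp_all add: atLeast0LessThan)
    also have "\<dots> = (\<Sum>\<sigma> | \<sigma> permutes {..<n}.
        of_int (sign \<sigma>) * (\<Prod>i<n. A $$ (f i, f (\<sigma> i))))"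
    proof (intro sum.cong prod.cong refl arg_cong2[of _ _ _ _ "(*)"])
      fix \<sigma> i assume "\<sigma> \<in> {\<sigma>. \<sigma> permutes {..<n}}" "i \<in> {..<n}"
      then have "i < n" "\<sigma> i < n" using permutes_in_image[of \<sigma> "{..<n}" i] by auto
      then show "mat n n (\<lambda>(i, j). A $$ (f i, f j)) $$ (i, \<sigma> i) = A $$ (f i, f (\<sigma> i))" by simp
    qed
    finally show "(\<Sum>\<sigma> | \<sigma> permutes {..<n}.
        of_int (sign \<sigma>) * (\<Prod>i<n. A $$ (f i, f (\<sigma> i)))) =
        det (mat n n (\<lambda>(i, j). A $$ (f i, f j)))" ..
  qed
  also have "\<dots> = (\<Sum>f\<in>?F. of_bool (inj_on f {..<n}) * det A)"
  proof (intro sum.cong refl det_reindex assms(4))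
    fix f assume f: "f \<in> ?F"
    have "block_interval ns (block_of p ns i) \<subseteq> {..<n}" if "i < n" for i
      using block_interval_subset[OF block_of_in_interval(1)] that assms(3)
      by (simp add: block_offset_def)
    then show "f ` {..<n} \<subseteq> {..<n}" using f by (fastforce simp: PiE_iff)
  qed
  also have "\<dots> = (\<Prod>a<p. fact (ns a)) * det A"
    by (simp flip: sum_distrib_right add: sum_of_bool_inj_blocks[OF assms(3)])
  finally show ?thesis by simp
qed

end
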